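(* Let $\mathcal{F}$ be a finite-dimensional real vector space with dual space $\mathcal{E}=\mathcal{F}^*$, and let $\mathcal{M}\subset\mathcal{F}\times\mathcal{E}$ be a maximally monotone structure. Then there exist a finite-dimensional real vector space $\mathcal{F}_R$, with dual space $\mathcal{E}_R=\mathcal{F}_R^*$, a Dirac structure $\mathcal{D}\subset\mathcal{F}\times\mathcal{E}\times\mathcal{F}_R\times\mathcal{E}_R$ and a nonnegative Lagrange structure $\mathcal{R}\subset\mathcal{F}_R\times\mathcal{E}_R$ such that $\mathcal{M}=\mathcal{D}\circ\mathcal{R}$.
   Context: All vector spaces are real and finite-dimensional. For a space $\mathcal{F}$ with dual $\mathcal{E}=\mathcal{F}^*$, $\langle e\mid f\rangle$ denotes the duality pairing of $e\in\mathcal{E}$ and $f\in\mathcal{F}$. On $\mathcal{F}\times\mathcal{E}$ define the bilinear forms $\langle (f_1,e_1),(f_2,e_2)\rangle_{+}=\langle e_1\mid f_2\rangle+\langle e_2\mid f_1\rangle$ and $\langle (f_1,e_1),(f_2,e_2)\rangle_{-}=\langle e_1\mid f_2\rangle-\langle e_2\mid f_1\rangle$. A product $\mathcal{F}\times\mathcal{E}\times\mathcal{F}_R\times\mathcal{E}_R$ is identified with $(\mathcal{F}\times\mathcal{F}_R)\times(\mathcal{F}\times\mathcal{F}_R)^*$, with pairing $\langle e\mid f\rangle+\langle e_R\mid f_R\rangle$, so that the notions below apply to it. A linear subspace $\mathcal{D}$ is a Dirac structure if $\langle\cdot,\cdot\rangle_+$ vanishes on $\mathcal{D}$ and $\mathcal{D}$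 is maximal (with respect to inclusion among subspaces) with this property. A linear subspace $\mathcal{L}$ is a Lagrange structure if $\langle\cdot,\cdot\rangle_-$ vanishes on $\mathcal{L}$ and $\mathcal{L}$ is maximal with this property; it is nonnegative if moreover the quadratic form defined by $\langle\cdot,\cdot\rangle_+$ is nonnegative on $\mathcal{L}$ (i.e. $\langle e\mid f\rangle\ge 0$ for all $(f,e)\in\mathcal{L}$). A linear subspace $\mathcal{M}$ is a monotone structure if the quadratic form defined by $\langle\cdot,\cdot\rangle_+$ is nonnegative on $\mathcal{M}$ (i.e. $\langle e\mid f\rangle\ge0$ for all $(f,e)\in\mathcal{M}$); it is a maximally monotone structure if it is maximal with this property. The composition is $\mathcal{D}\circ\mathcal{R}=\{(f,e)\in\mathcal{F}\times\mathcal{E}\mid \text{there exist } f_R\in\mathcal{F}_R,\ e_R\in\mathcal{E}_R \text{ such that } (f,e,f_R,e_R)\in\mathcal{D},\ (-f_R,e_R)\in\mathcal{R}\}$. *)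

theory Defs
  imports "HOL-Analysis.Product_Vector" "HOL-Library.Function_Algebras"
begin

text \<open>Functions into a real vector space form a real vector space under the pointwise
  operations; addition comes from Function_Algebras, scaling is added here.\<close>

instantiation "fun" :: (type, real_vector) real_vector
begin

definition scaleR_fun :: "real \<Rightarrow> ('a \<Rightarrow> 'b) \<Rightarrow> 'a \<Rightarrow> 'b"
  where "scaleR_fun c f = (\<lambda>x. c *\<^sub>R f x)"

instance
  by standard (simp_all add: scaleR_fun_def plus_fun_def scaleR_add_right scaleR_add_left)

end

text \<open>A finite-dimensional real vector space is a finite-dimensional subspace of an ambient
  type of class \<open>real_vector\<close>; the ambient type itself may be infinite-dimensional.\<close>

definition fd_space :: "'v::real_vector set \<Rightarrow> bool"
  where "fd_space V \<longleftrightarrow> subspace V \<and> (\<exists>B. finite B \<and> span B = V)"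

text \<open>The dual of \<open>V\<close>: the linear functionals on \<open>V\<close>. The value \<open>0\<close> off \<open>V\<close> gives every
  functional exactly one representative, and the pointwise operations of the function type
  restrict to those of the dual. The pairing of \<open>e\<close> and \<open>f\<close> is \<open>e f\<close>.\<close>

definition dual_space :: "'v::real_vector set \<Rightarrow> ('v \<Rightarrow> real) set"
  where "dual_space V = {e. (\<forall>x\<in>V. \<forall>y\<in>V. e (x + y) = e x + e y) \<and>
                      (\<forall>c. \<forall>x\<in>V. e (c *\<^sub>R x) = c * e x) \<and>
                      (\<forall>x. x \<notin> V \<longrightarrow> e x = 0)}"

definition plus_form :: "'v \<times> ('v \<Rightarrow> real) \<Rightarrow> 'v \<times> ('v \<Rightarrow> real) \<Rightarrow> real"
  where "plus_form p q = snd p (fst q) + snd q (fst p)"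

definition minus_form :: "'v \<times> ('v \<Rightarrow> real) \<Rightarrow> 'v \<times> ('v \<Rightarrow> real) \<Rightarrow> real"
  where "minus_form p q = snd p (fst q) - snd q (fst p)"

definition linear_relation :: "'v::real_vector set \<Rightarrow> ('v \<times> ('v \<Rightarrow> real)) set \<Rightarrow> bool"
  where "linear_relation V S \<longleftrightarrow> subspace S \<and> S \<subseteq> V \<times> dual_space V"

definition maximal_with ::
  "(('v \<times> ('v \<Rightarrow> real)) set \<Rightarrow> bool) \<Rightarrow> 'v::real_vector set \<Rightarrow> ('v \<times> ('v \<Rightarrow> real)) set \<Rightarrow> bool"
  where "maximal_with P V S \<longleftrightarrow> linear_relation V S \<and> P S \<and>
           (\<forall>S'. linear_relation V S' \<and> P S' \<and> S \<subseteq> S' \<longrightarrow> S' = S)"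

definition dirac_structure :: "'v::real_vector set \<Rightarrow> ('v \<times> ('v \<Rightarrow> real)) set \<Rightarrow> bool"
  where "dirac_structure V = maximal_with (\<lambda>S. \<forall>p\<in>S. \<forall>q\<in>S. plus_form p q = 0) V"

definition lagrange_structure :: "'v::real_vector set \<Rightarrow> ('v \<times> ('v \<Rightarrow> real)) set \<Rightarrow> bool"
  where "lagrange_structure V = maximal_with (\<lambda>S. \<forall>p\<in>S. \<forall>q\<in>S. minus_form p q = 0) V"

definition nonnegative :: "('v \<times> ('v \<Rightarrow> real)) set \<Rightarrow> bool"
  where "nonnegative S \<longleftrightarrow> (\<forall>p\<in>S. plus_form p p \<ge> 0)"

definition nonnegative_lagrange_structure ::
  "'v::real_vector set \<Rightarrow> ('v \<times> ('v \<Rightarrow> real)) set \<Rightarrow> bool"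
  where "nonnegative_lagrange_structure V S \<longleftrightarrow> lagrange_structure V S \<and> nonnegative S"

definition monotone_structure :: "'v::real_vector set \<Rightarrow> ('v \<times> ('v \<Rightarrow> real)) set \<Rightarrow> bool"
  where "monotone_structure V S \<longleftrightarrow> linear_relation V S \<and> nonnegative S"

definition maximally_monotone_structure ::
  "'v::real_vector set \<Rightarrow> ('v \<times> ('v \<Rightarrow> real)) set \<Rightarrow> bool"
  where "maximally_monotone_structure V S \<longleftrightarrow> monotone_structure V S \<and>
           (\<forall>S'. monotone_structure V S' \<and> S \<subseteq> S' \<longrightarrow> S' = S)"

text \<open>The identification of \<open>F \<times> F* \<times> G \<times> G*\<close> with \<open>(F \<times> G) \<times> (F \<times> G)*\<close>.\<close>

definition regroup :: "'v::real_vector set \<Rightarrow> 'w::real_vector set \<Rightarrow>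
    'v \<times> ('v \<Rightarrow> real) \<times> 'w \<times> ('w \<Rightarrow> real) \<Rightarrow> ('v \<times> 'w) \<times> ('v \<times> 'w \<Rightarrow> real)"
  where "regroup F G = (\<lambda>(f, e, g, h).
           ((f, g), \<lambda>z. if z \<in> F \<times> G then e (fst z) + h (snd z) else 0))"

definition dirac_structure_on_product :: "'v::real_vector set \<Rightarrow> 'w::real_vector set \<Rightarrow>
    ('v \<times> ('v \<Rightarrow> real) \<times> 'w \<times> ('w \<Rightarrow> real)) set \<Rightarrow> bool"
  where "dirac_structure_on_product F G D \<longleftrightarrow>
           D \<subseteq> F \<times> dual_space F \<times> G \<times> dual_space G \<and> dirac_structure (F \<times> G) (regroup F G ` D)"

definition dirac_compose :: "'v::real_vector set \<Rightarrow> 'w::real_vector set \<Rightarrow>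
    ('v \<times> ('v \<Rightarrow> real) \<times> 'w \<times> ('w \<Rightarrow> real)) set \<Rightarrow> ('w \<times> ('w \<Rightarrow> real)) set \<Rightarrow>
    ('v \<times> ('v \<Rightarrow> real)) set"
  where "dirac_compose F G D R = {(f, e). f \<in> F \<and> e \<in> dual_space F \<and>
           (\<exists>g\<in>G. \<exists>h\<in>dual_space G. (f, e, g, h) \<in> D \<and> (- g, h) \<in> R)}"

lemma subspace_dual:
  assumes "subspace V" shows "subspace (dual_space V)"
  using assms
  by (auto simp: subspace_def dual_space_def zero_fun_def plus_fun_def scaleR_fun_def algebra_simps)

lemma dual_zero:
  assumes "subspace V" "e \<in> dual_space V" shows "e 0 = 0"
proof -
  have "e (0 *\<^sub>R 0) = 0 * e 0"
    using assms unfolding dual_space_def subspace_def by blast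
  then show ?thesis by simp
qed

lemma bij_betw_regroup:
  assumes F: "subspace F" and G: "subspace G"
  shows "bij_betw (regroup F G) (F \<times> dual_space F \<times> G \<times> dual_space G) ((F \<times> G) \<times> dual_space (F \<times> G))"
proof (rule bij_betwI')
  fix p q
  assume p: "p \<in> F \<times> dual_space F \<times> G \<times> dual_space G" and q: "q \<in> F \<times> dual_space F \<times> G \<times> dual_space G"
  obtain f e g h where pp: "p = (f, e, g, h)" by (cases p)
  obtain f' e' g' h' where qq: "q = (f', e', g', h')" by (cases q)
  show "regroup F G p = regroup F G q \<longleftrightarrow> p = q"
  proof
    assume eq: "regroup F G p = regroup F G q"
    have fun_eq: "e x + h y = e' x + h' y" if "x \<in> F" "y \<in> G" for x y
      using that eq unfolding pp qq regroup_def by (auto dest!: fun_cong[where x = "(x, y)"])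
    have z: "e 0 = 0" "e' 0 = 0" "h 0 = 0" "h' 0 = 0"
      using p q F G by (auto simp: pp qq dual_zero)
    have "e x = e' x" for x
      using fun_eq[of x 0] z p q subspace_0[OF G] by (cases "x \<in> F") (auto simp: pp qq dual_space_def)
    moreover have "h y = h' y" for y
      using fun_eq[of 0 y] z p q subspace_0[OF F] by (cases "y \<in> G") (auto simp: pp qq dual_space_def)
    ultimately show "p = q"
      using eq by (auto simp: pp qq regroup_def)
  qed simp
next
  fix p
  assume p: "p \<in> F \<times> dual_space F \<times> G \<times> dual_space G"
  then show "regroup F G p \<in> (F \<times> G) \<times> dual_space (F \<times> G)"
    using F G by (auto simp: regroup_def dual_space_def subspace_def algebra_simps)
next
  fix r
  assume r: "r \<in> (F \<times> G) \<times> dual_space (F \<times> G)"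
  obtain f g u where rr: "r = ((f, g), u)" by (metis surj_pair)
  have u: "u \<in> dual_space (F \<times> G)" using r by (simp add: rr)
  have 0: "0 \<in> F" "0 \<in> G" using F G by (auto simp: subspace_0)
  have add: "u (x + x', y + y') = u (x, y) + u (x', y')"
    if "x \<in> F" "x' \<in> F" "y \<in> G" "y' \<in> G" for x x' y y'
  proof -
    have "u ((x, y) + (x', y')) = u (x, y) + u (x', y')"
      using u that unfolding dual_space_def by blast
    then show ?thesis by simp
  qed
  have scale: "u (c *\<^sub>R x, c *\<^sub>R y) = c * u (x, y)" if "x \<in> F" "y \<in> G" for c x y
  proof -
    have "u (c *\<^sub>R (x, y)) = c * u (x, y)"
      using u that unfolding dual_space_def by blast
    then show ?thesis by simp
  qed
  define e where "e = (\<lambda>x. if x \<in> F then u (x, 0) else 0)"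
  define h where "h = (\<lambda>y. if y \<in> G then u (0, y) else 0)"
  have "e \<in> dual_space F"
    using F add[of _ _ 0 0] scale[of _ 0] 0 by (auto simp: e_def dual_space_def subspace_def)
  moreover have "h \<in> dual_space G"
    using G add[of 0 0] scale[of 0] 0 by (auto simp: h_def dual_space_def subspace_def)
  moreover have "u z = (if z \<in> F \<times> G then e (fst z) + h (snd z) else 0)" for z
    using u 0 add[of "fst z" 0 0 "snd z"]
    by (cases z) (auto simp: e_def h_def dual_space_def)
  then have "regroup F G (f, e, g, h) = r"
    by (auto simp: rr regroup_def)
  ultimately show "\<exists>p\<in>F \<times> dual_space F \<times> G \<times> dual_space G. r = regroup F G p"
    using r by (intro bexI[of _ "(f, e, g, h)"]) (auto simp: rr)
qed

text \<open>Every finite-dimensional real vector space is isomorphic to a subspace of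
  \<open>nat \<Rightarrow> real\<close>, so quantifying existentially over finite-dimensional spaces up to
  isomorphism may be done inside this one type.\<close>

lemma fd_space_isomorphic_copy:
  fixes V :: "'v::real_vector set"
  assumes "fd_space V"
  shows "\<exists>T :: 'v \<Rightarrow> nat \<Rightarrow> real. linear T \<and> inj_on T V \<and> fd_space (T ` V)"
proof -
  obtain A where A: "finite A" "span A = V"
    using assms by (auto simp: fd_space_def)
  obtain B where B: "B \<subseteq> A" "independent B" "A \<subseteq> span B"
    using maximal_independent_subset[of A] by blast
  have finB: "finite B" using A B finite_subset by blast
  have spanB: "span B = V"
    using A(2) B(1,3) by (metis span_mono span_span subset_antisym)
  obtain idx :: "'v \<Rightarrow> nat" where idx: "inj_on idx B"
    using finite_imp_inj_to_nat_seg[OF finB] by blast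
  obtain T :: "'v \<Rightarrow> nat \<Rightarrow> real" where T: "linear T"
    and Tb: "\<And>b. b \<in> B \<Longrightarrow> T b = (\<lambda>n. if n = idx b then 1 else 0)"
    using linear_independent_extend[OF B(2), of "\<lambda>b n. if n = idx b then 1 else 0"] by blast
  have sum_apply: "(\<Sum>x\<in>X. f x) n = (\<Sum>x\<in>X. f x n)"
    for f :: "'v \<Rightarrow> nat \<Rightarrow> real" and X n
    by (induction X rule: infinite_finite_induct) auto
  have "v = 0" if v: "v \<in> V" "T v = 0" for v
  proof -
    obtain r where r: "v = (\<Sum>b\<in>B. r b *\<^sub>R b)"
      using v spanB span_finite[OF finB] by auto
    have "r b = 0" if b: "b \<in> B" for b
    proof -
      have "T v = (\<Sum>a\<in>B. r a *\<^sub>R T a)"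
        by (simp add: r linear_sum[OF T] linear_scale[OF T])
      then have "T v (idx b) = (\<Sum>a\<in>B. r a * T a (idx b))"
        by (simp add: sum_apply scaleR_fun_def)
      also have "\<dots> = (\<Sum>a\<in>B. if a = b then r a else 0)"
        by (rule sum.cong) (use b idx in \<open>auto simp: Tb inj_on_def\<close>)
      also have "\<dots> = r b" using b finB by simp
      finally show ?thesis using v by simp
    qed
    then show ?thesis by (simp add: r)
  qed
  then have "inj_on T V"
    using linear_injective_on_subspace_0[OF T] assms by (auto simp: fd_space_def)
  moreover have "fd_space (T ` V)"
    unfolding fd_space_def
    using assms linear_subspace_image[OF T] linear_span_image[OF T, of B] finB spanB
    by (metis fd_space_def finite_imageI)
  ultimately show ?thesis using T by blast
qed

end

theory Submission
  imports Defs
begin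

text \<open>Let \<open>\<F>\<^sub>R\<close> be a copy of \<open>\<M>\<close> itself and \<open>\<R>\<close> the graph of
  \<open>Q: \<M> \<rightarrow> \<M>*\<close>, \<open>Q m m' = \<langle>m, m'\<rangle>\<^sub>+ / 2\<close>, which is symmetric and positive semidefinite. The
  vectors \<open>(f, e, -m, Q m)\<close> with \<open>m = (f, e) \<in> \<M>\<close> form an isotropic subspace for
  \<open>\<langle>\<cdot>,\<cdot>\<rangle>\<^sub>+\<close>; let \<open>\<D>\<close> be a maximal isotropic extension. Then \<open>\<D> \<circ> \<R>\<close> contains \<open>\<M>\<close>, and it is
  monotone since \<open>\<langle>e | f\<rangle> = - \<langle>e\<^sub>R | f\<^sub>R\<rangle> \<ge> 0\<close>, so maximality of \<open>\<M>\<close> gives equality.\<close>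

section \<open>Finite-dimensionality of subspaces, products and duals\<close>

text \<open>An independent subset of the span of a finite set is finite, so a basis chosen inside
  \<open>V\<close> is a finite spanning set. In this form the property passes to subspaces at once,
  and it can be proved by bounding \<open>V\<close> from above only.\<close>

lemma fd_space_iff_finite_subset_span:
  "fd_space V \<longleftrightarrow> subspace V \<and> (\<exists>A. finite A \<and> V \<subseteq> span A)"
proof
  assume "subspace V \<and> (\<exists>A. finite A \<and> V \<subseteq> span A)"
  then obtain A where V: "subspace V" and A: "finite A" "V \<subseteq> span A" by blast
  obtain B where B: "B \<subseteq> V" "independent B" "V \<subseteq> span B"
    using maximal_independent_subset[of V] by blast
  have "finite B"
    using independent_span_bound[OF A(1) B(2)] A(2) B(1) by blast
  moreover have "span B = V"
    using B V by (simp add: span_minimal subset_antisym)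
  ultimately show "fd_space V" using V by (auto simp: fd_space_def)
qed (auto simp: fd_space_def)

lemma fd_space_subset: "fd_space V \<Longrightarrow> subspace W \<Longrightarrow> W \<subseteq> V \<Longrightarrow> fd_space W"
  unfolding fd_space_iff_finite_subset_span by blast

lemma fd_space_Times:
  assumes "fd_space V" "fd_space W"
  shows "fd_space (V \<times> W)"
proof -
  obtain A B where A: "finite A" "span A = V" and B: "finite B" "span B = W"
    using assms by (auto simp: fd_space_def)
  let ?C = "(\<lambda>v. (v, 0)) ` A \<union> (\<lambda>w. (0, w)) ` B"
  have lin: "linear (\<lambda>v. (v, 0 :: 'b))" "linear (\<lambda>w. (0 :: 'a, w))"
    by (auto intro!: linearI)
  have "(v, w) \<in> span ?C" if "v \<in> V" "w \<in> W" for v w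
  proof -
    have "(v, 0) \<in> span ((\<lambda>v. (v, 0 :: 'b)) ` A)" "(0, w) \<in> span ((\<lambda>w. (0 :: 'a, w)) ` B)"
      using that A B by (auto simp: linear_span_image[OF lin(1)] linear_span_image[OF lin(2)])
    then have "(v, 0) + (0, w) \<in> span ?C"
      by (meson span_add span_mono subsetD sup_ge1 sup_ge2)
    then show ?thesis by simp
  qed
  moreover have "finite ?C" using A B by simp
  ultimately show ?thesis
    using assms unfolding fd_space_iff_finite_subset_span
    by (metis subrelI SigmaE2 subspace_Times)
qed

lemma dual_space_add: "e \<in> dual_space V \<Longrightarrow> x \<in> V \<Longrightarrow> y \<in> V \<Longrightarrow> e (x + y) = e x + e y"
  and dual_space_scale: "e \<in> dual_space V \<Longrightarrow> x \<in> V \<Longrightarrow> e (c *\<^sub>R x) = c * e x"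
  and dual_space_outside: "e \<in> dual_space V \<Longrightarrow> x \<notin> V \<Longrightarrow> e x = 0"
  by (auto simp: dual_space_def)

text \<open>Elements of \<open>dual_space V\<close> are additive only on \<open>V\<close>; hence the
  induction also keeps the partial sums in \<open>V\<close>.\<close>

lemma dual_space_sum:
  assumes V: "subspace V" and e: "e \<in> dual_space V" and X: "\<And>b. b \<in> B \<Longrightarrow> x b \<in> V"
  shows "e (\<Sum>b\<in>B. x b) = (\<Sum>b\<in>B. e (x b))"
  using X
proof (induction B rule: infinite_finite_induct)
  case (insert b B)
  then have "(\<Sum>b\<in>B. x b) \<in> V" by (simp add: subspace_sum[OF V])
  with insert show ?case by (simp add: dual_space_add[OF e])
qed (simp_all add: dual_zero[OF V e])

text \<open>The coordinate functionals of a finite basis span the dual: a functional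
  \<open>e\<close> is the combination of them with coefficients \<open>e b\<close>.\<close>

lemma fd_space_dual:
  assumes "fd_space V"
  shows "fd_space (dual_space V)"
proof -
  have V: "subspace V" using assms by (simp add: fd_space_def)
  obtain A where A: "finite A" "span A = V" using assms by (auto simp: fd_space_def)
  obtain B where B: "B \<subseteq> V" "independent B" "V \<subseteq> span B"
    using maximal_independent_subset[of V] by blast
  have finB: "finite B" using independent_span_bound[OF A(1) B(2)] A(2) B(1) by blast
  \<comment> \<open>The coordinate functional of \<open>b\<close>, extended by \<open>0\<close> off
    \<open>V\<close> as in \<open>dual_space\<close>, so that the expansion of \<open>e\<close>
    holds at every point of the type.\<close>
  define \<phi> where "\<phi> b x = (if x \<in> V then representation B x b else 0)" for b x
  have "e \<in> span (\<phi> ` B)" if e: "e \<in> dual_space V" for e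
  proof -
    have sum_apply: "(\<Sum>b\<in>X. f b) x = (\<Sum>b\<in>X. f b x)"
      for f :: "'a \<Rightarrow> 'a \<Rightarrow> real" and X x
      by (induction X rule: infinite_finite_induct) auto
    have "e x = (\<Sum>b\<in>B. e b *\<^sub>R \<phi> b) x" for x
    proof (cases "x \<in> V")
      case True
      have "e x = e (\<Sum>b\<in>B. representation B x b *\<^sub>R b)"
        using sum_representation_eq[OF B(2) _ finB order_refl, of x] True B(3) by auto
      also have "\<dots> = (\<Sum>b\<in>B. e (representation B x b *\<^sub>R b))"
        using B(1) by (intro dual_space_sum[OF V e]) (auto simp: subspace_scale[OF V])
      also have "\<dots> = (\<Sum>b\<in>B. representation B x b * e b)"
        using B(1) by (intro sum.cong) (auto simp: dual_space_scale[OF e])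
      finally show ?thesis
        using True by (simp add: sum_apply scaleR_fun_def \<phi>_def mult.commute)
    qed (simp add: sum_apply scaleR_fun_def \<phi>_def dual_space_outside[OF e])
    then have "e = (\<Sum>b\<in>B. e b *\<^sub>R \<phi> b)" by blast
    also have "\<dots> \<in> span (\<phi> ` B)"
      by (intro span_sum span_scale span_base imageI)
    finally show ?thesis .
  qed
  with finB show ?thesis
    unfolding fd_space_iff_finite_subset_span using subspace_dual[OF V] by blast
qed

section \<open>Existence of Dirac and Lagrange structures: maximal extensions and graphs\<close>

lemma plus_form_commute: "plus_form p q = plus_form q p"
  by (simp add: plus_form_def)

lemma plus_form_add:
  "p \<in> V \<times> dual_space V \<Longrightarrow> p' \<in> V \<times> dual_space V \<Longrightarrow> q \<in> V \<times> dual_space V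
    \<Longrightarrow> plus_form (p + p') q = plus_form p q + plus_form p' q"
  by (auto simp: plus_form_def dual_space_add)

lemma plus_form_scale:
  "p \<in> V \<times> dual_space V \<Longrightarrow> q \<in> V \<times> dual_space V
    \<Longrightarrow> plus_form (c *\<^sub>R p) q = c * plus_form p q"
  by (auto simp: plus_form_def dual_space_scale scaleR_fun_def algebra_simps)

text \<open>Zorn's lemma, applied to the isotropic subspaces that contain \<open>S\<close>; the
  union of a nonempty chain is an upper bound.\<close>

lemma dirac_structure_extension:
  assumes S: "linear_relation V S" "\<forall>p\<in>S. \<forall>q\<in>S. plus_form p q = 0"
  shows "\<exists>D. dirac_structure V D \<and> S \<subseteq> D"
proof -
  let ?A = "{D. linear_relation V D \<and> (\<forall>p\<in>D. \<forall>q\<in>D. plus_form p q = 0) \<and> S \<subseteq> D}"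
  have "\<exists>D\<in>?A. \<forall>X\<in>?A. D \<subseteq> X \<longrightarrow> X = D"
  proof (rule subset_Zorn_nonempty)
    show "?A \<noteq> {}" using S by blast
  next
    fix C assume C: "C \<noteq> {}" "subset.chain ?A C"
    \<comment> \<open>Closure under addition and vanishing of the form each involve two elements, so
      both can be checked inside a single member of the chain.\<close>
    have common: "\<exists>D\<in>C. p \<in> D \<and> q \<in> D" if "p \<in> \<Union>C" "q \<in> \<Union>C" for p q
    proof -
      obtain D E where DE: "D \<in> C" "p \<in> D" "E \<in> C" "q \<in> E" using \<open>p \<in> \<Union>C\<close> \<open>q \<in> \<Union>C\<close> by blast
      then have "D \<subseteq> E \<or> E \<subseteq> D" using C(2) by (auto simp: subset_chain_def)
      then show ?thesis using DE by blast
    qed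
    have CA: "C \<subseteq> ?A" using C(2) by (simp add: subset.chain_def)
    have sub: "subspace D" if "D \<in> C" for D
      using that CA by (auto simp: linear_relation_def)
    have "subspace (\<Union>C)"
    proof (rule subspaceI)
      show "0 \<in> \<Union>C" using C(1) sub subspace_0 by blast
      show "p + q \<in> \<Union>C" if "p \<in> \<Union>C" "q \<in> \<Union>C" for p q
        using common[OF that] sub subspace_add by blast
      show "c *\<^sub>R p \<in> \<Union>C" if "p \<in> \<Union>C" for c p
        using that sub subspace_scale by blast
    qed
    moreover have "\<Union>C \<subseteq> V \<times> dual_space V"
      using CA by (auto simp: linear_relation_def)
    moreover have "plus_form p q = 0" if "p \<in> \<Union>C" "q \<in> \<Union>C" for p q
      using common[OF that] CA by blast
    moreover have "S \<subseteq> \<Union>C" using C(1) CA by blast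
    ultimately show "\<Union>C \<in> ?A" by (simp add: linear_relation_def)
  qed
  then obtain D where D: "D \<in> ?A" and max: "\<forall>X\<in>?A. D \<subseteq> X \<longrightarrow> X = D"
    by (rule bexE)
  have "dirac_structure V D"
    unfolding dirac_structure_def maximal_with_def
  proof (intro conjI allI impI)
    \<comment> \<open>An isotropic \<open>X\<close> above \<open>D\<close> also contains
      \<open>S\<close>, so maximality within \<open>?A\<close> is maximality among all isotropic
      subspaces.\<close>
    fix X assume "linear_relation V X \<and> (\<forall>p\<in>X. \<forall>q\<in>X. plus_form p q = 0) \<and> D \<subseteq> X"
    with D show "X = D" by (intro max[rule_format]) auto
  qed (use D in auto)
  with D show ?thesis by blast
qed

text \<open>Symmetry of \<open>b\<close> makes its graph isotropic for \<open>minus_form\<close>.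
  The graph is maximal because a pair \<open>(x, h)\<close> that annihilates all of it satisfies
  \<open>h y = b x y\<close> for every \<open>y\<close> in \<open>G\<close>, which puts it on the
  graph.\<close>

lemma lagrange_structure_graph:
  fixes b :: "'w::real_vector \<Rightarrow> 'w \<Rightarrow> real"
  assumes G: "subspace G"
    and add: "\<And>x x' y. x \<in> G \<Longrightarrow> x' \<in> G \<Longrightarrow> y \<in> G \<Longrightarrow> b (x + x') y = b x y + b x' y"
    and scale: "\<And>c x y. x \<in> G \<Longrightarrow> y \<in> G \<Longrightarrow> b (c *\<^sub>R x) y = c * b x y"
    and sym: "\<And>x y. b x y = b y x"
  shows "lagrange_structure G ((\<lambda>x. (x, \<lambda>y. if y \<in> G then b x y else 0)) ` G)"
    (is "lagrange_structure G (?\<gamma> ` G)")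
proof -
  have "?\<gamma> x + ?\<gamma> y = ?\<gamma> (x + y)" if "x \<in> G" "y \<in> G" for x y
    using that by (auto simp: add)
  moreover have "c *\<^sub>R ?\<gamma> x = ?\<gamma> (c *\<^sub>R x)" if "x \<in> G" for c x
    using that by (auto simp: scale scaleR_fun_def)
  moreover have "0 = ?\<gamma> 0"
    using scale[of 0 _ 0] subspace_0[OF G] by (auto simp: zero_prod_def)
  ultimately have "subspace (?\<gamma> ` G)"
    unfolding subspace_def using G
    by (auto simp: subspace_add subspace_scale subspace_0)
  moreover have "?\<gamma> ` G \<subseteq> G \<times> dual_space G"
  proof -
    \<comment> \<open>Symmetry carries linearity over to the second argument.\<close>
    have "b x (y + y') = b x y + b x y'" if "x \<in> G" "y \<in> G" "y' \<in> G" for x y y'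
      using add[OF that(2,3,1)] by (simp add: sym)
    moreover have "b x (c *\<^sub>R y) = c * b x y" if "x \<in> G" "y \<in> G" for x c y
      using scale[OF that(2,1)] by (simp add: sym)
    ultimately show ?thesis
      by (auto simp: dual_space_def subspace_add[OF G] subspace_scale[OF G])
  qed
  moreover have "minus_form p q = 0" if "p \<in> ?\<gamma> ` G" "q \<in> ?\<gamma> ` G" for p q
    using that by (auto simp: minus_form_def sym)
  moreover have "S = ?\<gamma> ` G"
    if S: "linear_relation G S" "\<forall>p\<in>S. \<forall>q\<in>S. minus_form p q = 0" "?\<gamma> ` G \<subseteq> S" for S
  proof -
    have "p \<in> ?\<gamma> ` G" if p: "p \<in> S" for p
    proof -
      obtain x h where xh: "p = (x, h)" by (cases p)
      then have x: "x \<in> G" "h \<in> dual_space G"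
        using S(1) p by (auto simp: linear_relation_def)
      have "h y = b x y" if "y \<in> G" for y
      proof -
        have "minus_form p (?\<gamma> y) = 0" using S(2,3) p that by blast
        then show ?thesis using x by (simp add: xh minus_form_def sym)
      qed
      then have "p = ?\<gamma> x"
        using x by (auto simp: xh dual_space_outside)
      then show ?thesis using x by blast
    qed
    then show ?thesis using S(3) by blast
  qed
  ultimately show ?thesis
    unfolding lagrange_structure_def maximal_with_def linear_relation_def
    by (intro conjI allI impI ballI) (assumption | simp)+
qed

section \<open>The identification \<open>regroup\<close> and monotonicity of compositions\<close>

lemma linear_regroup: "linear (regroup F G)"
  by (rule linearI) (auto simp: regroup_def scaleR_fun_def fun_eq_iff algebra_simps)

text \<open>The identification is an isometry for the sum of the two plus forms, which lets isotropy
  of a Dirac structure on the product be read off componentwise.\<close>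

lemma plus_form_regroup:
  assumes "f \<in> F" "g \<in> G" "f' \<in> F" "g' \<in> G"
  shows "plus_form (regroup F G (f, e, g, h)) (regroup F G (f', e', g', h'))
    = plus_form (f, e) (f', e') + plus_form (g, h) (g', h')"
  using assms by (simp add: regroup_def plus_form_def)

text \<open>The Dirac property concerns the image of \<open>D\<close>. Since \<open>regroup\<close>
  is injective on the full product, \<open>D\<close> is the preimage of that image within the
  product, and preimages of subspaces under linear maps are subspaces.\<close>

lemma subspace_dirac_structure_on_product:
  assumes F: "subspace F" and G: "subspace G" and D: "dirac_structure_on_product F G D"
  shows "subspace D"
proof -
  let ?P = "F \<times> dual_space F \<times> G \<times> dual_space G"
  have P: "subspace ?P" by (intro subspace_Times F G subspace_dual)
  have sub: "D \<subseteq> ?P" and S: "subspace (regroup F G ` D)"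
    using D by (auto simp: dirac_structure_on_product_def dirac_structure_def maximal_with_def
        linear_relation_def)
  have "D = ?P \<inter> regroup F G -` (regroup F G ` D)"
    using sub bij_betw_imp_inj_on[OF bij_betw_regroup[OF F G]] unfolding inj_on_def by blast
  then show ?thesis
    by (metis P S linear_subspace_vimage linear_regroup subspace_inter)
qed

text \<open>For \<open>(f, e, g, h)\<close> in \<open>D\<close>, isotropy with itself gives
  \<open>e f + h g = 0\<close>, while \<open>(- g, h)\<close> in the nonnegative \<open>R\<close>
  gives \<open>h g \<le> 0\<close>; hence \<open>e f \<ge> 0\<close>.\<close>

lemma monotone_structure_compose:
  assumes F: "subspace F" and G: "subspace G" and D: "dirac_structure_on_product F G D"
    and R: "subspace R" "nonnegative R"
  shows "monotone_structure F (dirac_compose F G D R)"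
proof -
  note sD = subspace_dirac_structure_on_product[OF F G D]
  note sF = subspace_dual[OF F] and sG = subspace_dual[OF G]
  have "subspace (dirac_compose F G D R)"
  proof (rule subspaceI)
    show "0 \<in> dirac_compose F G D R"
      using subspace_0[OF sD] subspace_0[OF R(1)] subspace_0[OF F] subspace_0[OF G]
        subspace_0[OF sF] subspace_0[OF sG]
      unfolding dirac_compose_def zero_prod_def by force
  next
    fix p q assume "p \<in> dirac_compose F G D R" "q \<in> dirac_compose F G D R"
    then obtain f e g h f' e' g' h'
      where p: "p = (f, e)" "f \<in> F" "e \<in> dual_space F" "g \<in> G" "h \<in> dual_space G"
        "(f, e, g, h) \<in> D" "(- g, h) \<in> R"
      and q: "q = (f', e')" "f' \<in> F" "e' \<in> dual_space F" "g' \<in> G" "h' \<in> dual_space G"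
        "(f', e', g', h') \<in> D" "(- g', h') \<in> R"
      unfolding dirac_compose_def by blast
    have "(f + f', e + e', g + g', h + h') \<in> D"
      using subspace_add[OF sD p(6) q(6)] by simp
    moreover have "(- (g + g'), h + h') \<in> R"
      using subspace_add[OF R(1) p(7) q(7)] by (simp add: add.commute)
    ultimately show "p + q \<in> dirac_compose F G D R"
      using p(1) q(1) subspace_add[OF F p(2) q(2)] subspace_add[OF sF p(3) q(3)]
        subspace_add[OF G p(4) q(4)] subspace_add[OF sG p(5) q(5)]
      unfolding dirac_compose_def by (auto simp del: minus_add_distrib)
  next
    fix c p assume "p \<in> dirac_compose F G D R"
    then obtain f e g h
      where p: "p = (f, e)" "f \<in> F" "e \<in> dual_space F" "g \<in> G" "h \<in> dual_space G"
        "(f, e, g, h) \<in> D" "(- g, h) \<in> R"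
      unfolding dirac_compose_def by blast
    have "(c *\<^sub>R f, c *\<^sub>R e, c *\<^sub>R g, c *\<^sub>R h) \<in> D"
      using subspace_scale[OF sD p(6), of c] by simp
    moreover have "(- (c *\<^sub>R g), c *\<^sub>R h) \<in> R"
      using subspace_scale[OF R(1) p(7), of c] by simp
    ultimately show "c *\<^sub>R p \<in> dirac_compose F G D R"
      using p(1) subspace_scale[OF F p(2)] subspace_scale[OF sF p(3)]
        subspace_scale[OF G p(4)] subspace_scale[OF sG p(5)]
      unfolding dirac_compose_def by simp blast
  qed
  moreover have "plus_form p p \<ge> 0" if mem: "p \<in> dirac_compose F G D R" for p
  proof -
    obtain f e g h
      where p: "p = (f, e)" "f \<in> F" "g \<in> G" "h \<in> dual_space G"
        "(f, e, g, h) \<in> D" "(- g, h) \<in> R"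
      using mem unfolding dirac_compose_def by blast
    have "plus_form (regroup F G (f, e, g, h)) (regroup F G (f, e, g, h)) = 0"
      using D p(5)
      by (auto simp: dirac_structure_on_product_def dirac_structure_def maximal_with_def)
    moreover have "plus_form (- g, h) (- g, h) \<ge> 0"
      using R(2) p(6) by (auto simp: nonnegative_def)
    moreover have "h (- g) = - h g"
      using dual_space_scale[OF p(4,3), of "-1"] by simp
    ultimately show ?thesis
      using p(2,3) by (simp add: p(1) plus_form_regroup) (simp add: plus_form_def)
  qed
  ultimately show ?thesis
    by (auto simp: monotone_structure_def linear_relation_def nonnegative_def dirac_compose_def)
qed

section \<open>Construction of both structures from \<open>M\<close>\<close>

theorem proposition3p9:
  fixes F :: "'v::real_vector set"
    and M :: "('v \<times> ('v \<Rightarrow> real)) set"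
  assumes "fd_space F"
    and "maximally_monotone_structure F M"
  shows "\<exists>(F\<^sub>R :: (nat \<Rightarrow> real) set)
           (D :: ('v \<times> ('v \<Rightarrow> real) \<times> (nat \<Rightarrow> real) \<times> ((nat \<Rightarrow> real) \<Rightarrow> real)) set)
           (R :: ((nat \<Rightarrow> real) \<times> ((nat \<Rightarrow> real) \<Rightarrow> real)) set).
           fd_space F\<^sub>R \<and>
           dirac_structure_on_product F F\<^sub>R D \<and>
           nonnegative_lagrange_structure F\<^sub>R R \<and>
           M = dirac_compose F F\<^sub>R D R"
proof -
  have F: "subspace F" using assms(1) by (simp add: fd_space_def)
  have M: "subspace M" "M \<subseteq> F \<times> dual_space F" "nonnegative M"
    and max: "\<And>S. monotone_structure F S \<Longrightarrow> M \<subseteq> S \<Longrightarrow> S = M"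
    using assms(2)
    by (auto simp: maximally_monotone_structure_def monotone_structure_def linear_relation_def)
  \<comment> \<open>\<open>M\<close> is a subspace of the finite-dimensional
    \<open>F \<times> dual_space F\<close>, so it has an isomorphic copy in
    \<open>nat \<Rightarrow> real\<close>, the type required of the resistive space.\<close>
  have "fd_space M"
    using fd_space_subset[OF fd_space_Times[OF assms(1) fd_space_dual[OF assms(1)]] M(1,2)] .
  then obtain T :: "'v \<times> ('v \<Rightarrow> real) \<Rightarrow> nat \<Rightarrow> real"
    where T: "linear T" "inj_on T M" "fd_space (T ` M)"
    using fd_space_isomorphic_copy by blast
  obtain U where U: "linear U" "\<And>m. m \<in> M \<Longrightarrow> U (T m) = m"
    using linear_exists_left_inverse_on[OF T(1) M(1) T(2)] by blast
  define G where "G = T ` M"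
  have G: "subspace G" using T(3) by (simp add: G_def fd_space_def)
  have UG: "U x \<in> M" if "x \<in> G" for x using that U(2) by (auto simp: G_def)
  \<comment> \<open>The plus form of \<open>M\<close>, transported to the copy \<open>G\<close> by
    the inverse \<open>U\<close> of \<open>T\<close>. The factor 1/2 anticipates that
    \<open>plus_form\<close> of two graph points of \<open>b\<close> counts \<open>b\<close>
    twice.\<close>
  define b where "b x y = plus_form (U x) (U y) / 2" for x y
  have badd: "b (x + x') y = b x y + b x' y" if "x \<in> G" "x' \<in> G" "y \<in> G" for x x' y
    using plus_form_add[of "U x" F "U x'" "U y"] UG[OF that(1)] UG[OF that(2)] UG[OF that(3)] M(2)
    by (auto simp: b_def linear_add[OF U(1)] add_divide_distrib)
  have bscale: "b (c *\<^sub>R x) y = c * b x y" if "x \<in> G" "y \<in> G" for c x y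
    using plus_form_scale[of "U x" F "U y" c] UG[OF that(1)] UG[OF that(2)] M(2)
    by (auto simp: b_def linear_scale[OF U(1)])
  have bsym: "b x y = b y x" for x y by (simp add: b_def plus_form_commute)
  define q where "q x = (\<lambda>y. if y \<in> G then b x y else 0)" for x
  define R where "R = (\<lambda>x. (x, q x)) ` G"
  have LR: "lagrange_structure G R"
    unfolding R_def q_def using badd bscale bsym by (intro lagrange_structure_graph G)
  then have subR: "subspace R" and RG: "R \<subseteq> G \<times> dual_space G"
    by (auto simp: lagrange_structure_def maximal_with_def linear_relation_def)
  \<comment> \<open>On the graph point over \<open>x\<close>, \<open>plus_form\<close> takes the
    value \<open>2 * b x x = plus_form (U x) (U x)\<close>, which is nonnegative because
    \<open>U x\<close> lies in \<open>M\<close>.\<close>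
  have nnR: "nonnegative R"
    using UG M(3) by (auto simp: nonnegative_def R_def q_def b_def plus_form_def)
  have qG: "q x \<in> dual_space G" if "x \<in> G" for x
    using RG that by (auto simp: R_def)
  \<comment> \<open>The sign of \<open>T m\<close> is undone by the sign in the composition, so that
    the pair tested against \<open>R\<close> is the graph point over \<open>T m\<close>. It also
    makes the two contributions to the plus form cancel.\<close>
  define \<psi> where "\<psi> m = (fst m, snd m, - T m, q (T m))" for m
  have TG: "T m \<in> G" if "m \<in> M" for m using that by (simp add: G_def)
  have \<psi>P: "\<psi> m \<in> F \<times> dual_space F \<times> G \<times> dual_space G" if "m \<in> M" for m
    using that M(2) qG[OF TG] TG by (auto simp: \<psi>_def subspace_neg[OF G])
  let ?S = "regroup F G ` \<psi> ` M"
  have "subspace (\<psi> ` M)"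
  proof -
    have "q x + q y = q (x + y)" if "x \<in> G" "y \<in> G" for x y
      using that by (auto simp: q_def badd)
    then have "\<psi> m + \<psi> m' = \<psi> (m + m')" if "m \<in> M" "m' \<in> M" for m m'
      using that by (simp add: \<psi>_def TG linear_add[OF T(1)])
    moreover have "c *\<^sub>R q x = q (c *\<^sub>R x)" if "x \<in> G" for c x
      using that by (auto simp: q_def bscale scaleR_fun_def[where 'a = "nat \<Rightarrow> real"])
    then have scale: "c *\<^sub>R \<psi> m = \<psi> (c *\<^sub>R m)" if "m \<in> M" for c m
      using that by (simp add: \<psi>_def TG linear_scale[OF T(1)])
    moreover from scale[of 0 0] have "0 = \<psi> 0"
      using subspace_0[OF M(1)] by simp
    ultimately show ?thesis
      unfolding subspace_def using M(1)
      by (auto simp: subspace_add subspace_scale subspace_0)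
  qed
  then have "subspace ?S" by (rule linear_subspace_image[OF linear_regroup])
  moreover have "?S \<subseteq> (F \<times> G) \<times> dual_space (F \<times> G)"
    using \<psi>P bij_betw_imp_surj_on[OF bij_betw_regroup[OF F G]] by blast
  moreover have "plus_form (regroup F G (\<psi> m)) (regroup F G (\<psi> m')) = 0"
    if m: "m \<in> M" "m' \<in> M" for m m'
  proof -
    have neg: "q (T m) (- T m') = - q (T m) (T m')" if "m \<in> M" "m' \<in> M" for m m'
      using dual_space_scale[OF qG TG, of "T m" m' "-1"] TG that by simp
    have "plus_form (regroup F G (\<psi> m)) (regroup F G (\<psi> m'))
        = plus_form m m' + plus_form (- T m, q (T m)) (- T m', q (T m'))"
      using m M(2) TG unfolding \<psi>_def
      by (subst plus_form_regroup) (auto simp: subspace_neg[OF G])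
    also have "plus_form (- T m, q (T m)) (- T m', q (T m')) = - b (T m) (T m') - b (T m') (T m)"
      using m TG by (simp add: plus_form_def neg) (simp add: q_def)
    also have "\<dots> = - plus_form m m'"
      using m by (simp add: b_def U(2) plus_form_commute)
    finally show ?thesis by simp
  qed
  ultimately obtain S where S: "dirac_structure (F \<times> G) S" "?S \<subseteq> S"
    using dirac_structure_extension[of "F \<times> G" ?S] by (auto simp: linear_relation_def)
  \<comment> \<open>The Dirac extension \<open>S\<close> lives on the regrouped side;
    \<open>D\<close> is its pullback to quadruples. The intersection keeps \<open>D\<close> where
    \<open>regroup\<close> is a bijection, and surjectivity there gives back \<open>S\<close> as its
    image.\<close>
  define D where "D = (F \<times> dual_space F \<times> G \<times> dual_space G) \<inter> regroup F G -` S"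
  have "S \<subseteq> regroup F G ` (F \<times> dual_space F \<times> G \<times> dual_space G)"
    using S(1) unfolding bij_betw_imp_surj_on[OF bij_betw_regroup[OF F G]]
    by (simp add: dirac_structure_def maximal_with_def linear_relation_def)
  then have "regroup F G ` D = S"
    unfolding D_def subset_image_iff by auto
  then have D: "dirac_structure_on_product F G D"
    using S(1) by (simp add: dirac_structure_on_product_def D_def)
  have "M \<subseteq> dirac_compose F G D R"
  proof
    fix m assume m: "m \<in> M"
    \<comment> \<open>The witnesses for \<open>m\<close> are the last two components of
      \<open>\<psi> m\<close>.\<close>
    then have "\<psi> m \<in> D" using \<psi>P S(2) by (auto simp: D_def)
    moreover have "(- (- T m), q (T m)) \<in> R" using m TG by (simp add: R_def)
    ultimately have "(fst m, snd m) \<in> dirac_compose F G D R"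
      using \<psi>P[OF m] unfolding dirac_compose_def \<psi>_def by blast
    then show "m \<in> dirac_compose F G D R" by simp
  qed
  then have "M = dirac_compose F G D R"
    using max[OF monotone_structure_compose[OF F G D subR nnR]] by simp
  then show ?thesis
    using T(3) D LR nnR unfolding G_def nonnegative_lagrange_structure_def by blast
qed

end
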